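(* Let $(\Omega,\mathcal A)$ be a measurable space and let $K:\Omega\to\mathcal K'(\mathbb{C}^n)$ be a uniformly separable random compact subset of $\mathbb{C}^n$. For each non-empty compact set $Q\subset\mathbb{C}^n$ let $A(Q)$ be a family of continuous complex-valued functions on $Q$, such that whenever $Q_1\subset Q_2$ are non-empty compact subsets of $\mathbb{C}^n$ and $f\in A(Q_2)$, then $f|_{Q_1}\in A(Q_1)$. Then $A_{[\Omega]}^{\mathrm{unif}}(K)=A_{[\Omega]}(K)$.
   Context: $\mathcal K'(\mathbb{C}^n)$ denotes the space of non-empty compact subsets of $\mathbb{C}^n$ with the Hausdorff distance and its Borel $\sigma$-algebra. A random compact set (random compact subset) is a measurable function $K:\Omega\to\mathcal K'(\mathbb{C}^n)$. It is uniformly separable if there exists a countable subset $E$ of $\mathbb{C}^n$ whose intersection with $K(\omega)$ is dense in $K(\omega)$ for every $\omega\in\Omega$. Its graph is $\operatorname{Gr}K=\{(\omega,z)\in\Omega\times\mathbb{C}^n:z\in K(\omega)\}$, and $K^{-1}(z)=\{\omega\in\Omega:z\in K(\omega)\}$, which is a measurable set. A generalized random function is a function $f:\operatorname{Gr}K\to\mathbb{C}$ such that, for each $z\in\mathbb{C}^n$ with $K^{-1}(z)\ne\emptyset$, $f(\cdot,z):K^{-1}(z)\to\mathbb{C}$ is measurable. A generalized $A(K)$-random function is a generalized random function $f:\operatorname{Gr}K\to\mathbb{C}$ with $f(\omega,\cdot)\in A(K(\omega))$ for all $\omega\in\Omega$; a generalized $C(K)$-random function is the same with $C(K(\omega))$,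 the continuous complex-valued functions on $K(\omega)$, in place of $A(K(\omega))$. $A_{[\Omega]}(K)$ is the set of generalized $C(K)$-random functions $f$ for which there exists a sequence $\{f_j\}_{j\ge1}$ of generalized $A(K)$-random functions such that, for each $\omega\in\Omega$, $f_j(\omega,\cdot)\to f(\omega,\cdot)$ uniformly on $K(\omega)$. $A_{[\Omega]}^{\mathrm{unif}}(K)$ is the set of generalized $C(K)$-random functions $f$ for which there exists a sequence $\{f_j\}_{j\ge1}$ of generalized $A(K)$-random functions such that $f_j\to f$ uniformly on $\operatorname{Gr}K$. *)

theory Defs
  imports "HOL-Analysis.Analysis"
begin

text \<open>
  A function on a subset \<open>S\<close> of a type is represented by a total function that is
  \<^const>\<open>extensional\<close> on \<open>S\<close>, so that equality of functions on \<open>S\<close> is HOL equality and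
  restriction is \<^const>\<open>restrict\<close>.
\<close>

definition compacts :: "'a::metric_space set set"
  where "compacts = {Q. compact Q \<and> Q \<noteq> {}}"

text \<open>
  The value \<open>0\<close> off \<^term>\<open>compacts\<close> is a dummy; it is there because \<^locale>\<open>Metric_space\<close> demands
  nonnegativity on the whole type, while the suprema are meaningful only for bounded sets.
\<close>

definition hausdorff_dist :: "'a::metric_space set \<Rightarrow> 'a set \<Rightarrow> real"
  where "hausdorff_dist P Q =
    (if P \<in> compacts \<and> Q \<in> compacts
     then max (SUP p\<in>P. infdist p Q) (SUP q\<in>Q. infdist q P) else 0)"

lemma bdd_above_infdist_compact:
  assumes "P \<in> compacts"
  shows "bdd_above ((\<lambda>p. infdist p Q) ` P)"
proof -
  have "compact ((\<lambda>p. infdist p Q) ` P)"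
    using assms by (intro compact_continuous_image continuous_intros) (auto simp: compacts_def)
  then show ?thesis
    by (intro bounded_imp_bdd_above compact_imp_bounded)
qed

lemma infdist_le_hausdorff_dist:
  assumes "P \<in> compacts" "Q \<in> compacts" "p \<in> P"
  shows "infdist p Q \<le> hausdorff_dist P Q"
  using cSUP_upper[OF assms(3) bdd_above_infdist_compact[OF assms(1)], of Q] assms
  by (auto simp: hausdorff_dist_def)

lemma hausdorff_dist_le:
  assumes "P \<in> compacts" "Q \<in> compacts"
    and "\<And>p. p \<in> P \<Longrightarrow> infdist p Q \<le> c" "\<And>q. q \<in> Q \<Longrightarrow> infdist q P \<le> c"
  shows "hausdorff_dist P Q \<le> c"
  using assms by (auto simp: hausdorff_dist_def compacts_def intro!: cSUP_least)

lemma hausdorff_dist_commute: "hausdorff_dist P Q = hausdorff_dist Q P"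
  by (auto simp: hausdorff_dist_def max.commute)

lemma hausdorff_dist_nonneg: "0 \<le> hausdorff_dist P Q"
proof (cases "P \<in> compacts \<and> Q \<in> compacts")
  case True
  then obtain p where "p \<in> P" by (auto simp: compacts_def)
  then show ?thesis
    using True infdist_le_hausdorff_dist[of P Q p] infdist_nonneg[of p Q] by linarith
qed (auto simp: hausdorff_dist_def)

lemma infdist_hausdorff_triangle:
  assumes "Q \<in> compacts" "R \<in> compacts"
  shows "infdist x R \<le> infdist x Q + hausdorff_dist Q R"
proof -
  obtain q where q: "q \<in> Q" "infdist x Q = dist x q"
  proof -
    have "compact Q" "Q \<noteq> {}" using assms(1) by (auto simp: compacts_def)
    moreover have "continuous_on Q (dist x)" by (intro continuous_intros)
    ultimately obtain q where "q \<in> Q" "\<forall>y\<in>Q. dist x q \<le> dist x y"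
      using continuous_attains_inf by blast
    then have "infdist x Q = dist x q"
      by (intro antisym infdist_le) (auto simp: infdist_def intro!: cINF_greatest)
    with \<open>q \<in> Q\<close> show ?thesis using that by blast
  qed
  show ?thesis
    using infdist_triangle[of x R q] infdist_le_hausdorff_dist[OF assms q(1)] q(2) by linarith
qed

lemma Metric_space_hausdorff: "Metric_space compacts hausdorff_dist"
proof
  fix P Q R :: "'a set"
  show "0 \<le> hausdorff_dist P Q" "hausdorff_dist P Q = hausdorff_dist Q P"
    by (rule hausdorff_dist_nonneg, rule hausdorff_dist_commute)
  assume P: "P \<in> compacts" and Q: "Q \<in> compacts"
  then have cl: "closed P" "closed Q" "P \<noteq> {}" "Q \<noteq> {}"
    by (auto simp: compacts_def compact_imp_closed)
  show "hausdorff_dist P Q = 0 \<longleftrightarrow> P = Q"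
  proof
    assume 0: "hausdorff_dist P Q = 0"
    have "p \<in> Q" if "p \<in> P" for p
      using infdist_le_hausdorff_dist[OF P Q that] infdist_nonneg[of p Q] 0
      by (simp add: in_closed_iff_infdist_zero cl)
    moreover have "q \<in> P" if "q \<in> Q" for q
      using infdist_le_hausdorff_dist[OF Q P that] infdist_nonneg[of q P] 0
      by (simp add: in_closed_iff_infdist_zero cl hausdorff_dist_commute[of Q P])
    ultimately show "P = Q" by blast
  next
    assume "P = Q"
    then show "hausdorff_dist P Q = 0"
      by (intro antisym hausdorff_dist_nonneg hausdorff_dist_le P Q) auto
  qed
  assume R: "R \<in> compacts"
  show "hausdorff_dist P R \<le> hausdorff_dist P Q + hausdorff_dist Q R"
  proof (rule hausdorff_dist_le[OF P R])
    fix p assume "p \<in> P"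
    then show "infdist p R \<le> hausdorff_dist P Q + hausdorff_dist Q R"
      using infdist_hausdorff_triangle[OF Q R, of p] infdist_le_hausdorff_dist[OF P Q] by fastforce
  next
    fix r assume "r \<in> R"
    then show "infdist r P \<le> hausdorff_dist P Q + hausdorff_dist Q R"
      using infdist_hausdorff_triangle[OF Q P, of r] infdist_le_hausdorff_dist[OF R Q]
      by (fastforce simp: hausdorff_dist_commute[of Q P] hausdorff_dist_commute[of R Q])
  qed
qed

interpretation hausdorff: Metric_space compacts hausdorff_dist
  by (rule Metric_space_hausdorff)

definition hausdorff_borel :: "'a::metric_space set measure"
  where "hausdorff_borel = sigma compacts {U. openin hausdorff.mtopology U}"

definition random_compact :: "'w measure \<Rightarrow> ('w \<Rightarrow> 'a::metric_space set) \<Rightarrow> bool"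
  where "random_compact M K \<longleftrightarrow> K \<in> measurable M hausdorff_borel"

definition uniformly_separable :: "'w measure \<Rightarrow> ('w \<Rightarrow> 'a::metric_space set) \<Rightarrow> bool"
  where "uniformly_separable M K \<longleftrightarrow>
    (\<exists>E. countable E \<and> (\<forall>\<omega>\<in>space M. K \<omega> \<subseteq> closure (E \<inter> K \<omega>)))"

definition Gr :: "'w measure \<Rightarrow> ('w \<Rightarrow> 'a set) \<Rightarrow> ('w \<times> 'a) set"
  where "Gr M K = {(\<omega>, z). \<omega> \<in> space M \<and> z \<in> K \<omega>}"

definition K_inv :: "'w measure \<Rightarrow> ('w \<Rightarrow> 'a set) \<Rightarrow> 'a \<Rightarrow> 'w set"
  where "K_inv M K z = {\<omega> \<in> space M. z \<in> K \<omega>}"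

lemma sets_K_inv:
  assumes "random_compact M K"
  shows "K_inv M K z \<in> sets M"
proof -
  let ?N = "{Q \<in> compacts. z \<notin> Q}"
  have "\<exists>r>0. hausdorff.mball Q r \<subseteq> ?N" if Q: "Q \<in> compacts" "z \<notin> Q" for Q
  proof (intro exI conjI)
    show "infdist z Q > 0"
      using Q by (intro infdist_pos_not_in_closed) (auto simp: compacts_def compact_imp_closed)
    show "hausdorff.mball Q (infdist z Q) \<subseteq> ?N"
    proof
      fix P assume P: "P \<in> hausdorff.mball Q (infdist z Q)"
      then have "z \<notin> P"
        using infdist_le_hausdorff_dist[of P Q z] by (auto simp: hausdorff_dist_commute[of Q P])
      with P show "P \<in> ?N" by simp
    qed
  qed
  then have "openin hausdorff.mtopology ?N"
    by (auto simp: hausdorff.openin_mtopology)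
  then have N: "?N \<in> sets hausdorff_borel" and sp: "space hausdorff_borel = compacts"
    unfolding hausdorff_borel_def
    by (auto simp: hausdorff.openin_mtopology sets_measure_of_conv space_measure_of_conv)
  have K: "K \<in> measurable M hausdorff_borel"
    using assms by (simp add: random_compact_def)
  have "K_inv M K z = space M - (K -` ?N \<inter> space M)"
    using measurable_space[OF K] by (auto simp: K_inv_def sp)
  then show ?thesis
    using measurable_sets[OF K N] by auto
qed

definition generalized_random_functions ::
    "'w measure \<Rightarrow> ('w \<Rightarrow> (complex ^ 'n) set) \<Rightarrow> ('w \<times> (complex ^ 'n) \<Rightarrow> complex) set"
  where "generalized_random_functions M K =
    {f \<in> Gr M K \<rightarrow>\<^sub>E UNIV. \<forall>z. K_inv M K z \<noteq> {} \<longrightarrow>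
       (\<lambda>\<omega>. f (\<omega>, z)) \<in> borel_measurable (restrict_space M (K_inv M K z))}"

definition generalized_A_random_functions ::
    "((complex ^ 'n) set \<Rightarrow> (complex ^ 'n \<Rightarrow> complex) set) \<Rightarrow>
     'w measure \<Rightarrow> ('w \<Rightarrow> (complex ^ 'n) set) \<Rightarrow> ('w \<times> (complex ^ 'n) \<Rightarrow> complex) set"
  where "generalized_A_random_functions A M K =
    {f \<in> generalized_random_functions M K.
       \<forall>\<omega>\<in>space M. (\<lambda>z\<in>K \<omega>. f (\<omega>, z)) \<in> A (K \<omega>)}"

definition C_fun :: "(complex ^ 'n) set \<Rightarrow> (complex ^ 'n \<Rightarrow> complex) set"
  where "C_fun Q = {g \<in> Q \<rightarrow>\<^sub>E UNIV. continuous_on Q g}"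

abbreviation "generalized_C_random_functions \<equiv> generalized_A_random_functions C_fun"

definition A_Omega ::
    "((complex ^ 'n) set \<Rightarrow> (complex ^ 'n \<Rightarrow> complex) set) \<Rightarrow>
     'w measure \<Rightarrow> ('w \<Rightarrow> (complex ^ 'n) set) \<Rightarrow> ('w \<times> (complex ^ 'n) \<Rightarrow> complex) set"
  where "A_Omega A M K =
    {f \<in> generalized_C_random_functions M K.
       \<exists>F :: nat \<Rightarrow> _. (\<forall>j. F j \<in> generalized_A_random_functions A M K) \<and>
         (\<forall>\<omega>\<in>space M. uniform_limit (K \<omega>) (\<lambda>j z. F j (\<omega>, z)) (\<lambda>z. f (\<omega>, z)) sequentially)}"

definition A_Omega_unif ::
    "((complex ^ 'n) set \<Rightarrow> (complex ^ 'n \<Rightarrow> complex) set) \<Rightarrow>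
     'w measure \<Rightarrow> ('w \<Rightarrow> (complex ^ 'n) set) \<Rightarrow> ('w \<times> (complex ^ 'n) \<Rightarrow> complex) set"
  where "A_Omega_unif A M K =
    {f \<in> generalized_C_random_functions M K.
       \<exists>F :: nat \<Rightarrow> _. (\<forall>j. F j \<in> generalized_A_random_functions A M K) \<and>
         uniform_limit (Gr M K) F f sequentially}"

end

theory Submission
  imports Defs
begin

text \<open>
  Given generalized \<open>A(K)\<close>-random functions \<open>F\<^sub>j\<close> converging to \<open>f\<close> uniformly on each fibre \<open>K(\<omega>)\<close>,
  let \<open>N\<^sub>k(\<omega>)\<close> be the least \<open>j\<close> with \<open>|F\<^sub>j - f| \<le> 1/(k+1)\<close> on \<open>K(\<omega>)\<close>. Since both functions are
  continuous on the fibre, this bound need only be tested on the countable set provided by uniform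
  separability, so \<open>N\<^sub>k\<close> is measurable. The functions \<open>F (N\<^sub>k(\<omega>)) (\<omega>, z)\<close> are again generalized
  \<open>A(K)\<close>-random functions, and they converge to \<open>f\<close> uniformly on the whole graph.
\<close>

text \<open>\<open>hausdorff_borel\<close> has underlying space \<open>compacts\<close>, so
  measurability of \<open>K\<close> already makes every fibre nonempty and compact.\<close>

lemma random_compact_in_compacts:
  assumes "random_compact M K" "\<omega> \<in> space M"
  shows "K \<omega> \<in> compacts"
  using assms measurable_space[of K M hausdorff_borel \<omega>]
  by (simp add: random_compact_def hausdorff_borel_def space_measure_of_conv)

lemma generalized_A_random_functions_mono:
  assumes "random_compact M K" "\<And>Q. Q \<in> compacts \<Longrightarrow> A Q \<subseteq> B Q"
  shows "generalized_A_random_functions A M K \<subseteq> generalized_A_random_functions B M K"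
  using random_compact_in_compacts[OF assms(1)] assms(2)
  by (fastforce simp: generalized_A_random_functions_def)

lemma continuous_on_generalized_C_random_function:
  assumes "f \<in> generalized_C_random_functions M K" "\<omega> \<in> space M"
  shows "continuous_on (K \<omega>) (\<lambda>z. f (\<omega>, z))"
proof -
  have "continuous_on (K \<omega>) (\<lambda>z\<in>K \<omega>. f (\<omega>, z))"
    using assms by (auto simp: generalized_A_random_functions_def C_fun_def)
  then show ?thesis
    by (simp cong: continuous_on_cong)
qed

lemma measurable_generalized_random_function:
  assumes "f \<in> generalized_random_functions M K"
  shows "(\<lambda>\<omega>. f (\<omega>, z)) \<in> borel_measurable (restrict_space M (K_inv M K z))"
proof (cases "K_inv M K z = {}")
  case True
  then have "space (restrict_space M (K_inv M K z)) = {}"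
    by (simp add: space_restrict_space)
  then show ?thesis
    by (simp add: measurable_def)
next
  case False
  then show ?thesis
    using assms by (auto simp: generalized_random_functions_def)
qed

text \<open>The set is a countable intersection over the set \<open>E\<close> from uniform
  separability: for each \<open>z\<close> in \<open>E\<close>, either \<open>z\<close> lies outside
  \<open>K \<omega>\<close> or the bound holds at \<open>z\<close>, and each such condition is
  measurable.\<close>

lemma sets_uniformly_close:
  assumes K: "random_compact M K" "uniformly_separable M K"
    and f: "f \<in> generalized_C_random_functions M K"
    and g: "g \<in> generalized_C_random_functions M K"
  shows "{\<omega> \<in> space M. \<forall>z\<in>K \<omega>. dist (f (\<omega>, z)) (g (\<omega>, z)) \<le> c} \<in> sets M"
proof -
  obtain E where E: "countable E" "\<And>\<omega>. \<omega> \<in> space M \<Longrightarrow> K \<omega> \<subseteq> closure (E \<inter> K \<omega>)"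
    using K(2) by (auto simp: uniformly_separable_def)
  let ?D = "\<lambda>z. {\<omega> \<in> K_inv M K z. dist (f (\<omega>, z)) (g (\<omega>, z)) \<le> c}"
  have D: "?D z \<in> sets M" for z
  proof -
    let ?R = "restrict_space M (K_inv M K z)"
    have inv: "K_inv M K z \<in> sets M"
      by (rule sets_K_inv[OF K(1)])
    then have sp: "space ?R = K_inv M K z"
      using sets.sets_into_space by (auto simp: space_restrict_space)
    have [measurable]: "(\<lambda>\<omega>. f (\<omega>, z)) \<in> borel_measurable ?R"
      "(\<lambda>\<omega>. g (\<omega>, z)) \<in> borel_measurable ?R"
      using f g
      by (auto intro!: measurable_generalized_random_function
          simp: generalized_A_random_functions_def)
    have "{\<omega> \<in> space ?R. dist (f (\<omega>, z)) (g (\<omega>, z)) \<le> c} \<in> sets ?R"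
      by measurable
    \<comment> \<open>Sets measurable in the restricted space are measurable in \<open>M\<close>
      because \<open>K_inv M K z\<close> itself is.\<close>
    then show ?thesis
      using inv by (simp add: sp sets_restrict_space_iff)
  qed
  have eq: "(\<forall>z\<in>K \<omega>. dist (f (\<omega>, z)) (g (\<omega>, z)) \<le> c) \<longleftrightarrow>
      (\<forall>z\<in>E. \<omega> \<in> (space M - K_inv M K z) \<union> ?D z)" if \<omega>: "\<omega> \<in> space M" for \<omega>
  proof
    assume R: "\<forall>z\<in>E. \<omega> \<in> (space M - K_inv M K z) \<union> ?D z"
    have "closed (K \<omega>)"
      using random_compact_in_compacts[OF K(1) \<omega>] by (simp add: compacts_def compact_imp_closed)
    then have cl: "closure (E \<inter> K \<omega>) = K \<omega>"
      using E(2)[OF \<omega>] by (simp add: antisym closure_minimal)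
    \<comment> \<open>The fibre is the closure of \<open>E \<inter> K \<omega>\<close>, so by
      continuity the non-strict bound extends from this dense subset to all of
      \<open>K \<omega>\<close>.\<close>
    have "continuous_on (closure (E \<inter> K \<omega>)) (\<lambda>z. dist (f (\<omega>, z)) (g (\<omega>, z)))"
      unfolding cl using f g \<omega>
      by (intro continuous_intros continuous_on_generalized_C_random_function)
    then show "\<forall>z\<in>K \<omega>. dist (f (\<omega>, z)) (g (\<omega>, z)) \<le> c"
      using continuous_le_on_closure[of "E \<inter> K \<omega>" _ _ c] R \<omega>
      by (fastforce simp: cl K_inv_def)
  qed (use \<omega> in \<open>auto simp: K_inv_def\<close>)
  have "{\<omega> \<in> space M. \<forall>z\<in>E. \<omega> \<in> (space M - K_inv M K z) \<union> ?D z} \<in> sets M"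
  proof (rule sets.sets_Collect_countable_All'[OF _ E(1)])
    fix z
    have "{\<omega> \<in> space M. \<omega> \<in> (space M - K_inv M K z) \<union> ?D z} = (space M - K_inv M K z) \<union> ?D z"
      by (auto simp: K_inv_def)
    also have "\<dots> \<in> sets M"
      using D sets_K_inv[OF K(1)] by (intro sets.Un sets.compl_sets)
    finally show "{\<omega> \<in> space M. \<omega> \<in> (space M - K_inv M K z) \<union> ?D z} \<in> sets M" .
  qed
  then show ?thesis
    by (simp only: eq cong: conj_cong)
qed

text \<open>The index depends on \<open>\<omega>\<close> alone. On a single fibre the new function
  is therefore one of the \<open>F j\<close>, while for fixed \<open>z\<close> it is glued from
  countably many measurable functions along the level sets of \<open>N\<close>.\<close>

lemma generalized_A_random_functions_select:
  fixes N :: "'w \<Rightarrow> nat"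
  assumes F: "\<And>j. F j \<in> generalized_A_random_functions A M K"
    and N: "N \<in> measurable M (count_space UNIV)"
  shows "(\<lambda>p\<in>Gr M K. F (N (fst p)) p) \<in> generalized_A_random_functions A M K"
    (is "?G \<in> _")
proof -
  have "(\<lambda>\<omega>. ?G (\<omega>, z)) \<in> borel_measurable (restrict_space M (K_inv M K z))" for z
  proof -
    have "(\<lambda>\<omega>. F (N \<omega>) (\<omega>, z)) \<in> borel_measurable (restrict_space M (K_inv M K z))"
    proof (rule measurable_compose_countable)
      show "(\<lambda>\<omega>. F j (\<omega>, z)) \<in> borel_measurable (restrict_space M (K_inv M K z))" for j
        using F[of j]
        by (auto intro!: measurable_generalized_random_function
            simp: generalized_A_random_functions_def)
    qed (rule measurable_restrict_space1[OF N])
    then show ?thesis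
      by (rule measurable_cong[THEN iffD1, rotated])
        (auto simp: space_restrict_space K_inv_def Gr_def)
  qed
  moreover have "(\<lambda>z\<in>K \<omega>. ?G (\<omega>, z)) \<in> A (K \<omega>)" if "\<omega> \<in> space M" for \<omega>
  proof -
    have "(\<lambda>z\<in>K \<omega>. ?G (\<omega>, z)) = (\<lambda>z\<in>K \<omega>. F (N \<omega>) (\<omega>, z))"
      using that by (auto simp: Gr_def fun_eq_iff)
    then show ?thesis
      using F[of "N \<omega>"] that by (simp add: generalized_A_random_functions_def)
  qed
  ultimately show ?thesis
    by (auto simp: generalized_A_random_functions_def generalized_random_functions_def)
qed

text \<open>Composing with the section \<open>z \<mapsto> (\<omega>, z)\<close>, which maps
  \<open>K \<omega>\<close> into the graph, turns uniform convergence on the graph into uniform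
  convergence on each fibre.\<close>

lemma A_Omega_unif_subset: "A_Omega_unif A M K \<subseteq> A_Omega A M K"
proof -
  have "uniform_limit (K \<omega>) (\<lambda>j z. F j (\<omega>, z)) (\<lambda>z. f (\<omega>, z)) sequentially"
    if "uniform_limit (Gr M K) F f sequentially" "\<omega> \<in> space M" 
    for F :: "nat \<Rightarrow> _" and f :: "_ \<Rightarrow> complex" and \<omega>
    by (rule uniform_limit_compose'[OF that(1)]) (use that(2) in \<open>auto simp: Gr_def\<close>)
  then show ?thesis
    unfolding A_Omega_unif_def A_Omega_def by blast
qed

lemma A_Omega_subset:
  assumes K: "random_compact M K" "uniformly_separable M K"
    and A: "\<And>Q. Q \<in> compacts \<Longrightarrow> A Q \<subseteq> C_fun Q"
  shows "A_Omega A M K \<subseteq> A_Omega_unif A M K"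
proof
  fix f assume "f \<in> A_Omega A M K"
  then obtain F where f: "f \<in> generalized_C_random_functions M K"
    and F: "\<And>j::nat. F j \<in> generalized_A_random_functions A M K"
    and lim: "\<And>\<omega>. \<omega> \<in> space M \<Longrightarrow>
      uniform_limit (K \<omega>) (\<lambda>j z. F j (\<omega>, z)) (\<lambda>z. f (\<omega>, z)) sequentially"
    by (auto simp: A_Omega_def)
  have FC: "F j \<in> generalized_C_random_functions M K" for j
    using F generalized_A_random_functions_mono[OF K(1), of A C_fun] A by blast
  \<comment> \<open>The inequality is non-strict, as \<open>sets_uniformly_close\<close> requires;
    \<open>Suc k\<close> keeps the tolerance meaningful at \<open>k = 0\<close>.\<close>
  define close where
    "close k j \<omega> \<longleftrightarrow> (\<forall>z\<in>K \<omega>. dist (F j (\<omega>, z)) (f (\<omega>, z)) \<le> 1 / real (Suc k))" for k j \<omega>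
  define N where "N k \<omega> = (LEAST j. close k j \<omega>)" for k \<omega>
  define G where "G k = (\<lambda>p\<in>Gr M K. F (N k (fst p)) p)" for k
  have "Measurable.pred M (close k j)" for k j
    unfolding pred_def close_def by (rule sets_uniformly_close[OF K FC f])
  then have "N k \<in> measurable M (count_space UNIV)" for k
    unfolding N_def[abs_def] by (rule measurable_Least)
  then have G: "G k \<in> generalized_A_random_functions A M K" for k
    unfolding G_def by (rule generalized_A_random_functions_select[OF F])
  \<comment> \<open>Fibrewise convergence enters here: it supplies an index satisfying
    \<open>close\<close>, so that \<open>LEAST\<close> really selects one.\<close>
  have close_N: "close k (N k \<omega>) \<omega>" if \<omega>: "\<omega> \<in> space M" for k \<omega>
  proof -
    have "\<forall>\<^sub>F j in sequentially. \<forall>z\<in>K \<omega>. dist (F j (\<omega>, z)) (f (\<omega>, z)) < 1 / real (Suc k)"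
      by (rule uniform_limitD[OF lim[OF \<omega>]]) simp
    then have "\<exists>j. close k j \<omega>"
      unfolding close_def eventually_sequentially by (meson less_imp_le order_refl)
    then show ?thesis
      unfolding N_def by (rule LeastI_ex)
  qed
  \<comment> \<open>The tolerance no longer depends on \<open>\<omega>\<close>, which is what makes
    the convergence uniform on the whole graph.\<close>
  have bound: "dist (G k p) (f p) \<le> 1 / real (Suc k)" if "p \<in> Gr M K" for k p
    using that close_N by (auto simp: G_def close_def Gr_def)
  have "uniform_limit (Gr M K) G f sequentially"
  proof (rule uniform_limitI)
    fix e :: real assume "e > 0"
    with LIMSEQ_inverse_real_of_nat
    have "\<forall>\<^sub>F k in sequentially. inverse (real (Suc k)) < e"
      by (rule order_tendstoD)
    then show "\<forall>\<^sub>F k in sequentially. \<forall>p\<in>Gr M K. dist (G k p) (f p) < e"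
      by eventually_elim (use bound in \<open>fastforce simp: inverse_eq_divide intro: le_less_trans\<close>)
  qed
  with f G show "f \<in> A_Omega_unif A M K"
    by (auto simp: A_Omega_unif_def)
qed

theorem theorem5p3:
  fixes M :: "'w measure"
    and K :: "'w \<Rightarrow> (complex ^ 'n) set"
    and A :: "(complex ^ 'n) set \<Rightarrow> (complex ^ 'n \<Rightarrow> complex) set"
  assumes "random_compact M K"
    and "uniformly_separable M K"
    and "\<And>Q. Q \<in> compacts \<Longrightarrow> A Q \<subseteq> C_fun Q"
    and "\<And>Q1 Q2 f. Q1 \<in> compacts \<Longrightarrow> Q2 \<in> compacts \<Longrightarrow> Q1 \<subseteq> Q2 \<Longrightarrow> f \<in> A Q2 \<Longrightarrow>
           restrict f Q1 \<in> A Q1"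
  shows "A_Omega_unif A M K = A_Omega A M K"
  by (intro antisym A_Omega_unif_subset A_Omega_subset assms)

end
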